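(* Let $N,M$ be positive integers, let $\mathcal A,\mathcal M\in\mathbb C^{N\times N}$ with $\mathcal A$ Hermitian positive semi-definite and $\mathcal M$ Hermitian positive definite, let $\mathcal B\in\mathbb C^{N\times M}$ satisfy $\mathcal A\mathcal M^{-1}\mathcal B=0$, let $\mathcal U\in\mathbb C^{M\times M}$ be Hermitian positive definite, let $c>0$ be real, let $\mathcal F\in\mathbb C^N$ and let $0\neq\mathcal G\in\operatorname{Im}\mathcal B^*\subset\mathbb C^M$. Suppose $\dim\mathbb C_0=0$. Then the constrained system $$(\mathcal A+c\mathcal M)u+\mathcal B p=\mathcal F,\qquad \mathcal B^* u=\mathcal G\qquad (u\in\mathbb C^N,\ p\in\mathbb C^M)$$ has a solution $(u,p)$ whose component $u$ is unique, and this $u$ is obtained as follows: there are unique $u_g,\tilde u\in\mathbb C^N$ with $$(\mathcal A+\mathcal B\mathcal U\mathcal B^* )u_g=\mathcal B\mathcal U\mathcal G,\qquad (\mathcal A+\mathcal B\mathcal U\mathcal B^* )\tilde u=\mathcal F,$$ and then $u$ is the unique solution in $\mathbb C^N$ of $$(\mathcal A+c\mathcal M)u=\mathcal F-\mathcal B\mathcal U\mathcal B^*\tilde u+c\mathcal M u_g.$$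
   Context: $X^*$ denotes the conjugate transpose of a matrix $X$. $\mathbb C_0:=\operatorname{Ker}\mathcal A\cap\operatorname{Ker}(\mathcal B\mathcal U\mathcal B^* )\subset\mathbb C^N$. *)

theory Defs
  imports "HOL-Analysis.Analysis"
begin

definition conj_transpose :: "complex^'n^'m \<Rightarrow> complex^'m^'n" where
  "conj_transpose X = (\<chi> i j. cnj (X $ j $ i))"

definition mat_ker :: "complex^'n^'m \<Rightarrow> (complex^'n) set" where
  "mat_ker X = {x. X *v x = 0}"

definition hermitian_mat :: "complex^'n^'n \<Rightarrow> bool" where
  "hermitian_mat X \<longleftrightarrow> conj_transpose X = X"

text \<open>The value of \<open>x\<^sup>* X x\<close>. The library's inner product on \<^typ>\<open>complex^'n\<close> is only the
  real part of the sesquilinear one, so the form is written out.\<close>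

definition quad_form :: "complex^'n^'n \<Rightarrow> complex^'n \<Rightarrow> complex" where
  "quad_form X x = (\<Sum>i\<in>UNIV. cnj (x $ i) * (X *v x) $ i)"

text \<open>For a Hermitian matrix the form is real-valued, so comparing its real part with 0 loses
  nothing.\<close>

definition hermitian_psd :: "complex^'n^'n \<Rightarrow> bool" where
  "hermitian_psd X \<longleftrightarrow> hermitian_mat X \<and> (\<forall>x. Re (quad_form X x) \<ge> 0)"

definition hermitian_pd :: "complex^'n^'n \<Rightarrow> bool" where
  "hermitian_pd X \<longleftrightarrow> hermitian_mat X \<and> (\<forall>x. x \<noteq> 0 \<longrightarrow> Re (quad_form X x) > 0)"

text \<open>The space \<open>\<complex>\<^sub>0\<close>. Its dimension over the complex numbers is \<^const>\<open>vec.dim\<close>;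
  the plain \<^const>\<open>dim\<close> would be the real dimension.\<close>

definition C0 :: "complex^'n^'n \<Rightarrow> complex^'m^'n \<Rightarrow> complex^'m^'m \<Rightarrow> (complex^'n) set" where
  "C0 A B U = mat_ker A \<inter> mat_ker (B ** U ** conj_transpose B)"

end

(*
Write K = B U B* and S = A + K. The hypothesis A M^{-1} B = 0 decouples the ranges of A and B: if
A x lies in the range of B, then A M^{-1} A x = 0, so A x = 0 because M^{-1} is definite. This makes
S injective, and applied to u_g it gives A u_g = 0 and B* u_g = G. As F - K u~ = A u~, the last
equation becomes (A + c M)(u - u_g) = A u~; applying B* M^{-1}, whose product with A vanishes, yields
c B*(u - u_g) = 0, hence B* u = G. A multiplier exists because M Ker A lies in the range of B.
*)
theory Submission
  imports Defs
begin

section \<open>Sesquilinear inner product and adjoints\<close>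

definition cinner :: "complex^'n \<Rightarrow> complex^'n \<Rightarrow> complex" where
  "cinner x y = (\<Sum>i\<in>UNIV. cnj (x $ i) * y $ i)"

lemma quad_form_eq_cinner: "quad_form X x = cinner x (X *v x)"
  by (simp add: quad_form_def cinner_def)

lemma cinner_zero_left [simp]: "cinner 0 y = 0"
  and cinner_zero_right [simp]: "cinner x 0 = 0"
  by (simp_all add: cinner_def)

lemma cinner_add_right: "cinner x (y + z) = cinner x y + cinner x z"
  by (simp add: cinner_def algebra_simps sum.distrib)

lemma cinner_scaleR_right: "cinner x (r *\<^sub>R y) = r *\<^sub>R cinner x y"
  by (simp add: cinner_def scaleR_sum_right)

lemma cinner_self_eq_0:
  assumes "cinner x x = 0"
  shows "x = 0"
proof -
  have "cinner x x = of_real (\<Sum>i\<in>UNIV. (cmod (x $ i))\<^sup>2)"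
    by (simp add: cinner_def complex_norm_square mult.commute del: of_real_power)
  with assms have "(\<Sum>i\<in>UNIV. (cmod (x $ i))\<^sup>2) = 0"
    by (metis of_real_eq_0_iff)
  then show ?thesis
    by (simp add: sum_nonneg_eq_0_iff vec_eq_iff)
qed

lemma cinner_conj_transpose: "cinner x (X *v y) = cinner (conj_transpose X *v x) y"
proof -
  have "cinner x (X *v y) = (\<Sum>i\<in>UNIV. \<Sum>j\<in>UNIV. cnj (x $ i) * (X $ i $ j * y $ j))"
    by (simp add: cinner_def matrix_vector_mult_def sum_distrib_left)
  also have "\<dots> = (\<Sum>j\<in>UNIV. \<Sum>i\<in>UNIV. cnj (x $ i) * (X $ i $ j * y $ j))"
    by (rule sum.swap)
  also have "\<dots> = cinner (conj_transpose X *v x) y"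
    by (simp add: cinner_def matrix_vector_mult_def conj_transpose_def sum_distrib_left
        mult.commute mult.left_commute)
  finally show ?thesis .
qed

lemma conj_transpose_conj_transpose [simp]: "conj_transpose (conj_transpose X) = X"
  by (simp add: conj_transpose_def)

lemma cinner_hermitian: "hermitian_mat X \<Longrightarrow> cinner x (X *v y) = cinner (X *v x) y"
  by (simp add: cinner_conj_transpose hermitian_mat_def)

lemma scaleR_matrix_vector_mult: "(r *\<^sub>R X) *v x = r *\<^sub>R (X *v x)"
  for X :: "complex^'n^'m"
  by (simp add: matrix_vector_mult_def vec_eq_iff scaleR_sum_right)

lemma matrix_vector_mult_scaleR_right: "X *v (r *\<^sub>R x) = r *\<^sub>R (X *v x)"
  for X :: "complex^'n^'m"
  by (simp add: matrix_vector_mult_def vec_eq_iff scaleR_sum_right)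

section \<open>Definiteness, invertibility and trivial kernels\<close>

lemma hermitian_pd_cinner_eq_0:
  assumes "hermitian_pd X" "cinner x (X *v x) = 0"
  shows "x = 0"
  using assms unfolding hermitian_pd_def quad_form_eq_cinner by force

lemma invertible_if_trivial_kernel:
  fixes X :: "'a::field^'n^'n"
  assumes "\<And>x. X *v x = 0 \<Longrightarrow> x = 0"
  shows "invertible X"
  using assms by (metis invertible_left_inverse matrix_left_invertible_ker)

lemma matrix_inv_vector_mult:
  fixes X :: "'a::field^'n^'n"
  assumes "invertible X"
  shows "X *v (matrix_inv X *v y) = y" and "matrix_inv X *v (X *v y) = y"
  \<comment> \<open>\<open>matrix_inv\<close> is a choice among two-sided inverses, so invertibility
    yields both identities at once.\<close>
  using someI_ex[OF assms[unfolded invertible_def]]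
  by (simp_all add: matrix_vector_mul_assoc flip: matrix_inv_def)

lemma ex1_solution_if_invertible:
  fixes X :: "'a::field^'n^'n"
  assumes "invertible X"
  shows "\<exists>!x. X *v x = y"
  using matrix_inv_vector_mult[OF assms] by metis

lemma hermitian_pd_invertible: "hermitian_pd X \<Longrightarrow> invertible X"
  by (rule invertible_if_trivial_kernel) (metis cinner_zero_right hermitian_pd_cinner_eq_0)

lemma psd_add_pd_cinner_eq_0:
  assumes "hermitian_psd A" "hermitian_pd M" "c > 0" "cinner x ((A + c *\<^sub>R M) *v x) = 0"
  shows "x = 0"
proof (rule ccontr)
  assume "x \<noteq> 0"
  then have "Re (cinner x (M *v x)) > 0" "Re (cinner x (A *v x)) \<ge> 0"
    using assms by (auto simp: hermitian_pd_def hermitian_psd_def quad_form_eq_cinner)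
  moreover have "Re (cinner x (A *v x)) + c * Re (cinner x (M *v x)) = 0"
    using arg_cong[OF assms(4), of Re]
    by (simp add: matrix_vector_mult_add_rdistrib scaleR_matrix_vector_mult
        cinner_add_right cinner_scaleR_right)
  ultimately show False
    using \<open>c > 0\<close> by (smt (verit) mult_pos_pos)
qed

lemma vec_dim_eq_0_imp_subset:
  fixes S :: "('a::field^'n) set"
  assumes "vec.dim S = 0"
  shows "S \<subseteq> {0}"
proof -
  obtain b where b: "b \<subseteq> S" "vec.independent b" "S \<subseteq> vec.span b" "card b = vec.dim S"
    using vec.basis_exists[of S] by blast
  \<comment> \<open>\<open>card b = 0\<close> also holds for infinite \<open>b\<close>; independence
    rules that case out.\<close>
  then have "b = {}"
    using assms vec.finiteI_independent by fastforce
  with b show ?thesis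
    by simp
qed

text \<open>Pairing \<open>B U B* x\<close> with \<open>x\<close> gives the \<open>U\<close>-form at
  \<open>B* x\<close>, which vanishes only at 0.\<close>

lemma hermitian_congruence_kernel:
  assumes "hermitian_pd U" "(B ** U ** conj_transpose B) *v x = 0"
  shows "conj_transpose B *v x = 0"
proof -
  have "cinner x ((B ** U ** conj_transpose B) *v x) = 0"
    using assms(2) by simp
  then have "cinner (conj_transpose B *v x) (U *v (conj_transpose B *v x)) = 0"
    by (simp add: cinner_conj_transpose[of x B] flip: matrix_vector_mul_assoc)
  then show ?thesis
    by (rule hermitian_pd_cinner_eq_0[OF assms(1)])
qed

section \<open>Consequences of A M^{-1} B = 0\<close>

context
  fixes A M :: "complex^'n^'n" and B :: "complex^'m^'n"
  assumes A: "hermitian_mat A" and M: "hermitian_pd M" and AMB: "A ** matrix_inv M ** B = 0"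
begin

lemma A_minv_B: "A *v (matrix_inv M *v (B *v p)) = 0"
  by (metis AMB matrix_vector_mul_assoc matrix_vector_mult_0)

text \<open>For \<open>z = M^{-1} A x\<close> the \<open>M\<close>-form is
  \<open>z* A x = (A z)* x = 0\<close>. Thus definiteness of \<open>M\<close> itself suffices,
  without passing to that of its inverse.\<close>

lemma A_minv_A_eq_0:
  assumes "A *v (matrix_inv M *v (A *v x)) = 0"
  shows "A *v x = 0"
proof -
  let ?z = "matrix_inv M *v (A *v x)"
  have Mz: "M *v ?z = A *v x"
    by (rule matrix_inv_vector_mult[OF hermitian_pd_invertible[OF M]])
  have "cinner ?z (M *v ?z) = cinner (A *v ?z) x"
    unfolding Mz by (rule cinner_hermitian[OF A])
  also have "\<dots> = 0"
    using assms by simp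
  finally have "?z = 0"
    by (rule hermitian_pd_cinner_eq_0[OF M])
  with Mz show ?thesis
    by simp
qed

lemma range_A_inter_range_B: "A *v x = B *v p \<Longrightarrow> A *v x = 0"
  by (rule A_minv_A_eq_0) (simp add: A_minv_B)

text \<open>This is the adjoint of \<open>A M^{-1} B = 0\<close>. Pairing the vector with itself and
  moving the factors across one at a time avoids showing that \<open>M^{-1}\<close> is
  Hermitian.\<close>

lemma Bstar_minv_A: "conj_transpose B *v (matrix_inv M *v (A *v x)) = 0"
proof -
  note inv = matrix_inv_vector_mult[OF hermitian_pd_invertible[OF M]]
  define g where "g = conj_transpose B *v (matrix_inv M *v (A *v x))"
  define w where "w = matrix_inv M *v (B *v g)"
  have "cinner g g = cinner (B *v g) (matrix_inv M *v (A *v x))"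
    by (subst (2) g_def) (simp add: cinner_conj_transpose)
  also have "\<dots> = cinner (M *v w) (matrix_inv M *v (A *v x))"
    by (simp add: w_def inv)
  also have "\<dots> = cinner w (A *v x)"
    using M by (simp add: inv hermitian_pd_def flip: cinner_hermitian)
  also have "\<dots> = cinner (A *v w) x"
    by (rule cinner_hermitian[OF A])
  also have "\<dots> = 0"
    by (simp add: w_def A_minv_B)
  finally show ?thesis
    unfolding g_def by (rule cinner_self_eq_0)
qed

text \<open>The equation says \<open>c M v = A (x - v)\<close>, and \<open>B* M^{-1}\<close>
  annihilates the right-hand side.\<close>

lemma Bstar_eq_0_if_regularized_in_range_A:
  assumes "c \<noteq> 0" "(A + c *\<^sub>R M) *v v = A *v x"
  shows "conj_transpose B *v v = 0"
proof -
  have Mv: "M *v (c *\<^sub>R v) = A *v (x - v)"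
    using assms(2)
    by (simp add: matrix_vector_mult_add_rdistrib scaleR_matrix_vector_mult
        matrix_vector_mult_diff_distrib matrix_vector_mult_scaleR_right algebra_simps)
  have "c *\<^sub>R (conj_transpose B *v v) = conj_transpose B *v (matrix_inv M *v (M *v (c *\<^sub>R v)))"
    by (simp add: matrix_inv_vector_mult[OF hermitian_pd_invertible[OF M]] matrix_vector_mult_scaleR_right)
  also have "\<dots> = 0"
    unfolding Mv by (rule Bstar_minv_A)
  finally show ?thesis
    using \<open>c \<noteq> 0\<close> by simp
qed

end

section \<open>The constrained system\<close>

text \<open>The difference \<open>u - v\<close> lies in the kernel of \<open>B*\<close>, hence is
  orthogonal to the range of \<open>B\<close>, where the multipliers act. So its
  \<open>A + c M\<close> form is zero, although \<open>p\<close> and \<open>q\<close> may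
  differ.\<close>

lemma regularized_saddle_point_unique:
  assumes A: "hermitian_psd A" and M: "hermitian_pd M" and c: "c > 0"
    and u: "(A + c *\<^sub>R M) *v u + B *v p = F" "conj_transpose B *v u = G"
    and v: "(A + c *\<^sub>R M) *v v + B *v q = F" "conj_transpose B *v v = G"
  shows "u = v"
proof -
  have "(A + c *\<^sub>R M) *v (u - v) = B *v (q - p)"
    using u(1) v(1) by (simp add: matrix_vector_mult_diff_distrib algebra_simps)
  then have "cinner (u - v) ((A + c *\<^sub>R M) *v (u - v)) = cinner (conj_transpose B *v (u - v)) (q - p)"
    by (simp add: cinner_conj_transpose[of _ B])
  also have "\<dots> = 0"
    using u(2) v(2) by (simp add: matrix_vector_mult_diff_distrib)
  finally show ?thesis
    using psd_add_pd_cinner_eq_0[OF A M c] by fastforce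
qed

theorem mainTheorem7:
  fixes A M :: "complex^'n^'n"
    and B :: "complex^'m^'n"
    and U :: "complex^'m^'m"
    and c :: real
    and F :: "complex^'n"
    and G :: "complex^'m"
  assumes "hermitian_psd A"
    and "hermitian_pd M"
    and "A ** matrix_inv M ** B = 0"
    and "hermitian_pd U"
    and "c > 0"
    and "G \<noteq> 0"
    and "G \<in> range (\<lambda>x. conj_transpose B *v x)"
    and "vec.dim (C0 A B U) = 0"
  shows "(\<exists>!u. \<exists>p. (A + c *\<^sub>R M) *v u + B *v p = F \<and> conj_transpose B *v u = G) \<and>
    (\<exists>!ug. (A + B ** U ** conj_transpose B) *v ug = B *v (U *v G)) \<and>
    (\<exists>!ut. (A + B ** U ** conj_transpose B) *v ut = F) \<and>
    (\<forall>ug ut.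
       (A + B ** U ** conj_transpose B) *v ug = B *v (U *v G) \<longrightarrow>
       (A + B ** U ** conj_transpose B) *v ut = F \<longrightarrow>
       (\<exists>!u. (A + c *\<^sub>R M) *v u =
               F - (B ** U ** conj_transpose B) *v ut + (c *\<^sub>R M) *v ug) \<and>
       (\<forall>u. (A + c *\<^sub>R M) *v u =
               F - (B ** U ** conj_transpose B) *v ut + (c *\<^sub>R M) *v ug \<longleftrightarrow>
            (\<exists>p. (A + c *\<^sub>R M) *v u + B *v p = F \<and> conj_transpose B *v u = G)))"
proof -
  let ?K = "B ** U ** conj_transpose B"
  let ?S = "A + ?K"
  let ?R = "A + c *\<^sub>R M"
  let ?sys = "\<lambda>u p. ?R *v u + B *v p = F \<and> conj_transpose B *v u = G"
  have A: "hermitian_mat A"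
    using assms(1) by (simp add: hermitian_psd_def)
  have K: "?K *v x = B *v (U *v (conj_transpose B *v x))" for x
    by (simp add: matrix_vector_mul_assoc matrix_mul_assoc)
  note range_AB = range_A_inter_range_B[OF A assms(2,3)]
  have "invertible ?S"
  proof (rule invertible_if_trivial_kernel)
    fix x assume x: "?S *v x = 0"
    then have "A *v x = - (?K *v x)"
      by (simp add: matrix_vector_mult_add_rdistrib eq_neg_iff_add_eq_0)
    also have "\<dots> = B *v (- (U *v (conj_transpose B *v x)))"
      unfolding K by (metis diff_0 matrix_vector_mult_0_right matrix_vector_mult_diff_distrib)
    finally have "A *v x = 0"
      by (rule range_AB)
    with x have "x \<in> C0 A B U"
      by (simp add: C0_def mat_ker_def matrix_vector_mult_add_rdistrib)
    then show "x = 0"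
      using vec_dim_eq_0_imp_subset[OF assms(8)] by blast
  qed
  note S_ex1 = ex1_solution_if_invertible[OF this]
  have "invertible ?R"
    by (rule invertible_if_trivial_kernel)
      (metis cinner_zero_right psd_add_pd_cinner_eq_0[OF assms(1,2,5)])
  note R_ex1 = ex1_solution_if_invertible[OF this]
  obtain w where w: "G = conj_transpose B *v w"
    using assms(7) by blast
  have solves: "\<exists>p. ?sys u p"
    if ug: "?S *v ug = B *v (U *v G)" and ut: "?S *v ut = F"
      and u: "?R *v u = F - ?K *v ut + (c *\<^sub>R M) *v ug" for ug ut u
  proof -
    \<comment> \<open>Writing \<open>G = B* w\<close> turns the right-hand side into
      \<open>K w\<close>, so \<open>A ug\<close> lies in the ranges of both \<open>A\<close> and
      \<open>B\<close>.\<close>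
    have Aug: "A *v ug = ?K *v (w - ug)"
      using ug w
      by (simp add: matrix_vector_mult_add_rdistrib matrix_vector_mult_diff_distrib K algebra_simps)
    then have Aug0: "A *v ug = 0"
      unfolding K by (rule range_AB)
    have "conj_transpose B *v (w - ug) = 0"
      using hermitian_congruence_kernel[OF assms(4)] Aug Aug0 by metis
    then have G: "conj_transpose B *v ug = G"
      by (simp add: w matrix_vector_mult_diff_distrib)
    \<comment> \<open>Here \<open>F - K ut = A ut\<close>, and \<open>A ug = 0\<close> makes
      \<open>c M ug\<close> equal to \<open>(A + c M) ug\<close>.\<close>
    have "?R *v (u - ug) = A *v ut"
      using u ut Aug0
      by (auto simp: matrix_vector_mult_add_rdistrib matrix_vector_mult_diff_distrib)
    with assms(5) have "conj_transpose B *v (u - ug) = 0"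
      by (intro Bstar_eq_0_if_regularized_in_range_A[OF A assms(2,3), of c]) simp_all
    then have Bu: "conj_transpose B *v u = G"
      using G by (simp add: matrix_vector_mult_diff_distrib)
    txt \<open>A vector in the kernel of \<open>A\<close> is mapped by \<open>M\<close> into the range of \<open>B\<close>: split
      \<open>M u\<^sub>g = A y + K y\<close> and apply \<open>A M\<^sup>-\<^sup>1\<close>.\<close>
    obtain y where y: "?S *v y = M *v ug"
      using S_ex1 by blast
    have "A *v (matrix_inv M *v (A *v y)) = A *v (matrix_inv M *v (M *v ug - ?K *v y))"
      by (simp flip: y add: matrix_vector_mult_add_rdistrib)
    also have "\<dots> = 0"
      by (simp add: matrix_vector_mult_diff_distrib Aug0 K A_minv_B[OF A assms(2,3)]
          matrix_inv_vector_mult[OF hermitian_pd_invertible[OF assms(2)]])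
    finally have Ay: "A *v y = 0"
      by (rule A_minv_A_eq_0[OF A assms(2,3)])
    \<comment> \<open>The multiplier must satisfy
      \<open>B p = F - (A + c M) u = K ut - c M ug\<close>. Since \<open>A y = 0\<close>,
      \<open>M ug = K y\<close>, and both terms factor through \<open>B U B*\<close>.\<close>
    define p where "p = U *v (conj_transpose B *v ut) - c *\<^sub>R (U *v (conj_transpose B *v y))"
    have "B *v p = ?K *v ut - (c *\<^sub>R M) *v ug"
      using y Ay by (simp add: p_def K matrix_vector_mult_diff_distrib matrix_vector_mult_scaleR_right
          matrix_vector_mult_add_rdistrib scaleR_matrix_vector_mult)
    then have "?R *v u + B *v p = F"
      using u by simp
    with Bu show ?thesis
      by blast
  qed
  have unique: "u = v" if "?sys u p" "?sys v q" for u v p q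
    using that regularized_saddle_point_unique[OF assms(1,2,5)] by blast
  have "\<exists>!u. \<exists>p. ?sys u p"
    using solves unique S_ex1 R_ex1 by metis
  \<comment> \<open>For the converse, the regularized equation has some solution; by
    \<open>solves\<close> it also solves the system, so \<open>unique\<close> identifies it with
    \<open>u\<close>.\<close>
  moreover have "?R *v u = F - ?K *v ut + (c *\<^sub>R M) *v ug \<longleftrightarrow> (\<exists>p. ?sys u p)"
    if "?S *v ug = B *v (U *v G)" "?S *v ut = F" for ug ut u
    using solves[OF that] unique R_ex1 by metis
  ultimately show ?thesis
    using S_ex1 R_ex1 by simp
qed

end
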